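(* For any $d$-dimensional convex body $B$, $h_\alpha(B)\ge d+1-\lceil\alpha\rceil$.
   Context: A $d$-dimensional convex body is a compact convex set $B\subset\mathbb{R}^d$ with non-empty interior. A boundary point $x$ of $B$ is illuminated by an oriented direction $l$ (given by a unit vector) if the ray from $x$ along the direction $l$ intersects the interior of $B$. For a real number $\alpha\ge 0$, $h_\alpha(B)$ denotes the minimal size of a set of directions $\mathcal{L}$ such that $\mathcal{L}$ illuminates all boundary points of $B$ (each by at least one of its directions) except for a subset whose Hausdorff dimension is less than $\alpha$. For $\alpha=0$, $h_0(B)$ is the minimal number of directions illuminating every boundary point of $B$.
   Formalization: Sets of directions are required to be non-empty: if the empty set were allowed, then for d-1 < α ≤ d the whole boundary has Hausdorff dimension d-1 < α, so h_α(B) = 0 and the bound 1 fails; other α are unaffected. *)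

theory Defs
  imports "HOL-Analysis.Analysis"
begin

definition convex_body :: "'a::euclidean_space set \<Rightarrow> bool" where
  "convex_body B \<longleftrightarrow> compact B \<and> convex B \<and> interior B \<noteq> {}"

(* The cost diam(U)^s of a covering set, with the usual conventions 0^0 = 1 for nonempty sets
   and cost 0 for the empty set; these have to be spelled out because 0 powr 0 = 0. *)
definition diam_pow :: "real \<Rightarrow> 'a::metric_space set \<Rightarrow> real" where
  "diam_pow s U = (if U = {} then 0 else if s = 0 then 1 else diameter U powr s)"

(* Boundedness is required explicitly: the diameter of an unbounded set is
   an unspecified real number. *)
definition delta_cover :: "real \<Rightarrow> 'a::metric_space set \<Rightarrow> (nat \<Rightarrow> 'a set) \<Rightarrow> bool" where
  "delta_cover \<delta> A U \<longleftrightarrow> A \<subseteq> (\<Union>i. U i) \<and> (\<forall>i. bounded (U i) \<and> diameter (U i) \<le> \<delta>)"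

definition hausdorff_premeasure :: "real \<Rightarrow> real \<Rightarrow> 'a::metric_space set \<Rightarrow> ennreal" where
  "hausdorff_premeasure s \<delta> A = (INF U\<in>{U. delta_cover \<delta> A U}. \<Sum>i. ennreal (diam_pow s (U i)))"

definition hausdorff_measure :: "real \<Rightarrow> 'a::metric_space set \<Rightarrow> ennreal" where
  "hausdorff_measure s A = (SUP \<delta>\<in>{0<..}. hausdorff_premeasure s \<delta> A)"

(* The empty set gets dimension -\<infinity>, so that it is the only set of dimension less than 0. *)
definition hausdorff_dim :: "'a::metric_space set \<Rightarrow> ereal" where
  "hausdorff_dim A =
     (if A = {} then -\<infinity> else Inf {ereal s | s. 0 \<le> s \<and> hausdorff_measure s A = 0})"

definition illuminates :: "'a::euclidean_space set \<Rightarrow> 'a \<Rightarrow> 'a \<Rightarrow> bool" where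
  "illuminates B l x \<longleftrightarrow> {x + t *\<^sub>R l | t. 0 \<le> t} \<inter> interior B \<noteq> {}"

definition dark_set :: "'a::euclidean_space set \<Rightarrow> 'a set \<Rightarrow> 'a set" where
  "dark_set B L = {x \<in> frontier B. \<forall>l\<in>L. \<not> illuminates B l x}"

(* Sets of directions are nonempty. Since adding directions only shrinks the dark set, this merely
   replaces the value 0 of the minimum below by 1; that happens only for \<alpha> > d - 1, when
   the whole boundary has Hausdorff dimension less than \<alpha>. *)
definition illuminating_set :: "real \<Rightarrow> 'a::euclidean_space set \<Rightarrow> 'a set \<Rightarrow> bool" where
  "illuminating_set \<alpha> B L \<longleftrightarrow>
     finite L \<and> L \<noteq> {} \<and> L \<subseteq> sphere 0 1 \<and> hausdorff_dim (dark_set B L) < ereal \<alpha>"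

definition illumination_number :: "real \<Rightarrow> 'a::euclidean_space set \<Rightarrow> nat" where
  "illumination_number \<alpha> B = (LEAST n. \<exists>L. illuminating_set \<alpha> B L \<and> card L = n)"

lemma hausdorff_dim_less_0_iff: "hausdorff_dim A < 0 \<longleftrightarrow> A = {}"
proof (cases "A = {}")
  case True
  then show ?thesis by (simp add: hausdorff_dim_def)
next
  case False
  then have "0 \<le> hausdorff_dim A"
    unfolding hausdorff_dim_def by (auto intro!: Inf_greatest)
  with False show ?thesis by auto
qed

lemma illuminating_set_0_iff:
  "illuminating_set 0 B L \<longleftrightarrow>
     finite L \<and> L \<noteq> {} \<and> L \<subseteq> sphere 0 1 \<and> (\<forall>x\<in>frontier B. \<exists>l\<in>L. illuminates B l x)"
  by (auto simp: illuminating_set_def hausdorff_dim_less_0_iff dark_set_def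
      simp flip: zero_ereal_def)

(* The minimum defining the illumination number is attained. *)
lemma illuminating_set_exists:
  fixes B :: "'a::euclidean_space set"
  assumes B: "convex_body B"
  shows "\<exists>L. illuminating_set \<alpha> B L"
proof -
  obtain z where z: "z \<in> interior B" using B by (auto simp: convex_body_def)
  define V where "V = (\<lambda>l. {y. illuminates B l y})"
  have opn: "open (V l)" for l
  proof -
    have "V l = (\<Union>t\<in>{0..}. (\<lambda>y. y + t *\<^sub>R l) -` interior B)"
      by (auto simp: V_def illuminates_def)
    moreover have "open ((\<lambda>y. y + t *\<^sub>R l) -` interior B)" for t
      by (intro open_vimage continuous_intros) auto
    ultimately show ?thesis by auto
  qed
  have cov: "frontier B \<subseteq> (\<Union>l\<in>sphere 0 1. V l)"
  proof
    fix x assume x: "x \<in> frontier B"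
    then have ne: "z \<noteq> x" using z by (auto simp: frontier_def)
    have "x + norm (z - x) *\<^sub>R sgn (z - x) = z"
      using ne by (simp add: sgn_div_norm)
    then have "x \<in> V (sgn (z - x))"
      using z unfolding V_def illuminates_def
      by (metis (mono_tags, lifting) IntI empty_iff mem_Collect_eq norm_ge_zero)
    moreover have "sgn (z - x) \<in> sphere 0 1" using ne by (simp add: norm_sgn)
    ultimately show "x \<in> (\<Union>l\<in>sphere 0 1. V l)" by blast
  qed
  have "compact (frontier B)"
    using B by (auto simp: convex_body_def compact_frontier)
  then obtain L where L: "L \<subseteq> sphere 0 1" "finite L" "frontier B \<subseteq> (\<Union>l\<in>L. V l)"
    by (rule compactE_image[OF _ _ cov]) (use opn in auto)
  obtain b :: 'a where b: "b \<in> Basis" using nonempty_Basis by blast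
  have "dark_set B (insert b L) = {}"
    using L by (auto simp: dark_set_def V_def)
  then have "hausdorff_dim (dark_set B (insert b L)) < ereal \<alpha>"
    by (simp add: hausdorff_dim_def)
  then have "illuminating_set \<alpha> B (insert b L)"
    using L b by (auto simp: illuminating_set_def)
  then show ?thesis ..
qed

end

theory Submission
  imports Defs
begin

text \<open>
  The point is that a set \<open>L\<close> of \<open>n \<le> d\<close> directions leaves a set of dimension at least \<open>d - n\<close>
  dark. Suppose that \<open>L\<close> lies in a subspace \<open>W\<close> with \<open>dim W \<le> n\<close> that contains some \<open>u \<noteq> 0\<close> making
  no obtuse angle with a direction of \<open>L\<close>. In each nonempty slice of \<open>B\<close> by a translate of \<open>W\<close>, a
  point \<open>x\<close> that is highest in direction \<open>u\<close> is dark: a ray from \<open>x\<close> along \<open>l \<in> L\<close> stays in the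
  slice and does not descend, whereas from an interior point one could still climb inside the
  slice (\<open>dark_point_in_fibre\<close>). Hence the orthogonal projection along \<open>W\<close> maps the dark set onto
  the whole projection of \<open>B\<close>, which contains a box of dimension \<open>d - dim W \<ge> d - n\<close>. Since the
  projection does not increase distances, comparing volumes of boxes bounds the Hausdorff dimension
  of the dark set from below (\<open>hausdorff_dim_ge_box\<close>).

  A suitable \<open>W\<close> always exists (\<open>nonneg_direction_exists\<close>). For independent directions take
  \<open>W = span L\<close>, where the linear functional equal to \<open>1\<close> on \<open>L\<close> is represented by some \<open>u\<close>; for
  dependent ones there is room to add a vector \<open>u\<close> orthogonal to \<open>L\<close>.

  Finally, if \<open>n\<close> directions illuminate up to dimension less than \<open>\<alpha>\<close> and \<open>n \<le> d\<close>, then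
  \<open>d - n < \<alpha> \<le> \<lceil>\<alpha>\<rceil>\<close>, which is the claim because both ends are integers. For \<open>n > d\<close> the claim is
  immediate from \<open>\<alpha> \<ge> 0\<close>.
\<close>

text \<open>
  A mass distribution argument with the Lebesgue measure on \<open>\<real>\<^sup>V\<close>: a covering set of diameter
  \<open>\<rho> \<le> 1\<close> has its image in a cube of side \<open>2\<rho>\<close>, and \<open>(2\<rho>)\<^sup>k \<le> 2\<^sup>k\<rho>\<^sup>s\<close> for \<open>s \<le> k = card V\<close>. These
  cubes must make up the volume \<open>(2r)\<^sup>k\<close>. Taking the product measure over \<open>V\<close> itself gives a volume
  in every dimension, including \<open>0\<close>, without choosing a space of that dimension.
\<close>

lemma hausdorff_premeasure_ge_box:
  fixes A :: "'a::euclidean_space set" and s :: real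
  assumes V: "finite V" "\<And>v. v \<in> V \<Longrightarrow> norm v = 1"
    and r: "0 < r"
    and box: "(\<Pi>\<^sub>E v\<in>V. {c v - r..c v + r}) \<subseteq> (\<lambda>x. \<lambda>v\<in>V. x \<bullet> v) ` A"
    and s: "0 \<le> s" "s \<le> card V"
  shows "ennreal (r ^ card V) \<le> hausdorff_premeasure s 1 A"
  unfolding hausdorff_premeasure_def
proof (rule INF_greatest)
  fix U assume "U \<in> {U. delta_cover 1 A U}"
  then have cov: "A \<subseteq> (\<Union>i. U i)" and bdd: "\<And>i. bounded (U i)"
    and diam: "\<And>i. diameter (U i) \<le> 1"
    by (auto simp: delta_cover_def)
  interpret product_sigma_finite "\<lambda>_::'a. lborel :: real measure" ..
  let ?M = "PiM V (\<lambda>_. lborel :: real measure)"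
  define k where "k = card V"
  have vol: "emeasure ?M (\<Pi>\<^sub>E v\<in>V. {a v - \<rho>..a v + \<rho>}) = ennreal ((2 * \<rho>) ^ k)"
    if "0 \<le> \<rho>" for a :: "'a \<Rightarrow> real" and \<rho> :: real
    using that V(1) by (subst emeasure_PiM) (auto simp: k_def ennreal_power)
  define p where "p i = (SOME x. x \<in> U i)" for i
  \<comment> \<open>An empty covering set costs nothing but has diameter \<open>0\<close>, so for \<open>k = 0\<close> its cube would have
    volume \<open>1\<close>.\<close>
  define Q where "Q i = (if U i = {} then {} else
      \<Pi>\<^sub>E v\<in>V. {p i \<bullet> v - diameter (U i)..p i \<bullet> v + diameter (U i)})" for i
  have Q_sets: "Q i \<in> sets ?M" for i
    using V(1) by (auto simp: Q_def intro!: sets_PiM_I_finite)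
  have Q_le: "emeasure ?M (Q i) \<le> ennreal (2 ^ k) * ennreal (diam_pow s (U i))" for i
  proof (cases "U i = {}")
    case False
    define \<rho> where "\<rho> = diameter (U i)"
    have \<rho>: "0 \<le> \<rho>" "\<rho> \<le> 1"
      using diameter_ge_0[OF bdd] diam by (auto simp: \<rho>_def)
    have "\<rho> ^ k \<le> diam_pow s (U i)"
    proof (cases "s = 0 \<or> \<rho> = 0")
      case True
      then show ?thesis
        using False \<rho> s by (auto simp: diam_pow_def \<rho>_def[symmetric] k_def power_le_one power_0_left)
    next
      case nz: False
      then have "\<rho> ^ k = \<rho> powr k"
        using \<rho> by (simp add: powr_realpow)
      also have "\<dots> \<le> \<rho> powr s"
        using nz \<rho> s by (intro powr_mono') (auto simp: k_def)
      finally show ?thesis using False nz by (simp add: diam_pow_def \<rho>_def)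
    qed
    then have "(2 * \<rho>) ^ k \<le> 2 ^ k * diam_pow s (U i)"
      by (simp add: power_mult_distrib)
    then show ?thesis
      using False vol[OF \<rho>(1)] by (simp add: Q_def \<rho>_def ennreal_mult'[symmetric] ennreal_leI)
  qed (simp add: Q_def diam_pow_def)
  have sub: "(\<Pi>\<^sub>E v\<in>V. {c v - r..c v + r}) \<subseteq> (\<Union>i. Q i)"
  proof
    fix z assume "z \<in> (\<Pi>\<^sub>E v\<in>V. {c v - r..c v + r})"
    then obtain x where x: "x \<in> A" "z = (\<lambda>v\<in>V. x \<bullet> v)" using box by auto
    then obtain i where i: "x \<in> U i" using cov by auto
    then have p: "p i \<in> U i" unfolding p_def by (rule someI)
    have "\<bar>x \<bullet> v - p i \<bullet> v\<bar> \<le> diameter (U i)" if "v \<in> V" for v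
    proof -
      have "\<bar>(x - p i) \<bullet> v\<bar> \<le> norm (x - p i) * norm v" by (rule Cauchy_Schwarz_ineq2)
      also have "\<dots> \<le> diameter (U i)"
        using diameter_bounded_bound[OF bdd i p] V(2)[OF that] by (simp add: dist_norm)
      finally show ?thesis by (simp add: inner_diff_left)
    qed
    then have "z \<in> Q i" using i by (auto simp: Q_def x(2) abs_le_iff algebra_simps)
    then show "z \<in> (\<Union>i. Q i)" by blast
  qed
  have "ennreal (2 ^ k) * ennreal (r ^ k) = emeasure ?M (\<Pi>\<^sub>E v\<in>V. {c v - r..c v + r})"
    using vol[of r c] r by (simp add: ennreal_mult'[symmetric] power_mult_distrib)
  also have "\<dots> \<le> emeasure ?M (\<Union>i. Q i)"
    using sub Q_sets by (intro emeasure_mono) auto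
  also have "\<dots> \<le> (\<Sum>i. emeasure ?M (Q i))"
    using Q_sets by (intro emeasure_subadditive_countably) auto
  also have "\<dots> \<le> (\<Sum>i. ennreal (2 ^ k) * ennreal (diam_pow s (U i)))"
    by (intro suminf_le Q_le) auto
  also have "\<dots> = ennreal (2 ^ k) * (\<Sum>i. ennreal (diam_pow s (U i)))"
    by simp
  finally show "ennreal (r ^ card V) \<le> (\<Sum>i. ennreal (diam_pow s (U i)))"
    by (subst (asm) ennreal_mult_le_mult_iff) (auto simp: k_def)
qed

lemma hausdorff_dim_ge_box:
  fixes A :: "'a::euclidean_space set"
  assumes V: "finite V" "\<And>v. v \<in> V \<Longrightarrow> norm v = 1"
    and r: "0 < r"
    and box: "(\<Pi>\<^sub>E v\<in>V. {c v - r..c v + r}) \<subseteq> (\<lambda>x. \<lambda>v\<in>V. x \<bullet> v) ` A"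
  shows "ereal (card V) \<le> hausdorff_dim A"
proof -
  have "(\<lambda>v\<in>V. c v) \<in> (\<Pi>\<^sub>E v\<in>V. {c v - r..c v + r})" using r by auto
  then have "A \<noteq> {}" using box by blast
  moreover have "card V \<le> s" if s: "0 \<le> s" "hausdorff_measure s A = 0" for s :: real
  proof (rule ccontr)
    assume "\<not> card V \<le> s"
    then have "ennreal (r ^ card V) \<le> hausdorff_premeasure s 1 A"
      using s by (intro hausdorff_premeasure_ge_box[OF V r box]) auto
    also have "\<dots> \<le> hausdorff_measure s A"
      unfolding hausdorff_measure_def by (rule SUP_upper) simp
    finally show False using s r by simp
  qed
  ultimately show ?thesis
    unfolding hausdorff_dim_def by (auto intro!: Inf_greatest)
qed

text \<open>
  The bound \<open>dim W \<le> card L\<close> leaves no slack for independent directions, so there \<open>u\<close> has to be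
  found within their span; dependent directions leave one dimension to spare.
\<close>

lemma nonneg_direction_exists:
  fixes L :: "'a::euclidean_space set"
  assumes L: "finite L" "L \<noteq> {}" "card L \<le> DIM('a)"
  obtains W u where "subspace W" "L \<subseteq> W" "dim W \<le> card L"
    "u \<in> W" "u \<noteq> 0" "\<And>l. l \<in> L \<Longrightarrow> 0 \<le> u \<bullet> l"
proof (cases "independent L")
  case True
  then obtain f :: "'a \<Rightarrow> real" where f: "linear f" "\<And>l. l \<in> L \<Longrightarrow> f l = 1"
    using linear_independent_extend[of L "\<lambda>_. 1"] by blast
  define w where "w = adjoint f 1"
  have w: "w \<bullet> x = f x" for x
    using adjoint_works[OF f(1), of x 1] by (simp add: w_def inner_commute)
  \<comment> \<open>The component of \<open>w\<close> in \<open>span L\<close> has the same inner products with \<open>L\<close>.\<close>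
  obtain u z where uz: "u \<in> span L" "\<And>y. y \<in> span L \<Longrightarrow> orthogonal z y" "w = u + z"
    using orthogonal_subspace_decomp_exists[of L w] by blast
  have u: "u \<bullet> l = 1" if "l \<in> L" for l
    using w[of l] f(2)[OF that] uz(2)[OF span_base[OF that]]
    by (simp add: uz(3) inner_add_left orthogonal_def)
  moreover have "u \<noteq> 0" using u L(2) by fastforce
  moreover have "dim (span L) \<le> card L" using L(1) by (simp add: dim_le_card')
  ultimately show ?thesis
    using that[of "span L" u] uz(1) span_superset[of L] by auto
next
  case False
  then have less: "dim L < card L"
    using L(1) card_le_dim_spanning[OF subset_refl span_superset L(1)] dim_le_card'[OF L(1)]
    by linarith
  with L(3) have "dim L < DIM('a)" by simp
  then obtain u where u: "u \<noteq> 0" "\<And>y. y \<in> span L \<Longrightarrow> orthogonal u y"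
    using orthogonal_to_subspace_exists by blast
  have "dim (span (insert u L)) \<le> card L"
    using less by (simp add: dim_insert)
  moreover have "0 \<le> u \<bullet> l" if "l \<in> L" for l
    using u(2)[OF span_base[OF that]] by (simp add: orthogonal_def)
  ultimately show ?thesis
    using that[of "span (insert u L)" u] u(1) span_superset[of "insert u L"] by auto
qed

text \<open>
  Take \<open>x\<close> with \<open>x \<bullet> u\<close> maximal on \<open>B \<inter> (b + W)\<close>. An interior point \<open>x + w\<close> with \<open>w \<in> W\<close> and
  \<open>0 \<le> u \<bullet> w\<close> could be pushed further along \<open>u\<close> within the slice and would beat the maximum. The
  case \<open>w = 0\<close> puts \<open>x\<close> on the boundary, and \<open>w = t *\<^sub>R l\<close> shows that \<open>l\<close> does not illuminate it.
\<close>

lemma dark_point_in_fibre: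
  fixes B :: "'a::euclidean_space set"
  assumes B: "compact B" and W: "subspace W" "L \<subseteq> W"
    and u: "u \<in> W" "u \<noteq> 0" "\<And>l. l \<in> L \<Longrightarrow> 0 \<le> u \<bullet> l"
    and b: "b \<in> B"
  obtains x where "x \<in> dark_set B L" "x - b \<in> W"
proof -
  define F where "F = B \<inter> (\<lambda>x. x - b) -` W"
  have "closed ((\<lambda>x. x - b) -` W)"
    using closed_subspace[OF W(1)] by (intro closed_vimage continuous_intros)
  then have "compact F" using B by (auto simp: F_def compact_Int_closed)
  moreover have "F \<noteq> {}" using b subspace_0[OF W(1)] by (auto simp: F_def)
  ultimately obtain x where x: "x \<in> F" and max: "\<And>y. y \<in> F \<Longrightarrow> y \<bullet> u \<le> x \<bullet> u"
    using continuous_attains_sup[of F "\<lambda>x. x \<bullet> u"]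
      continuous_on_inner[OF continuous_on_id continuous_on_const] by blast
  have no_int: "x + w \<notin> interior B" if w: "w \<in> W" "0 \<le> u \<bullet> w" for w
  proof
    assume "x + w \<in> interior B"
    then obtain e where e: "0 < e" "cball (x + w) e \<subseteq> B"
      by (auto simp: mem_interior_cball)
    define y where "y = x + w + (e / norm u) *\<^sub>R u"
    have "y \<in> cball (x + w) e" using e u(2) by (simp add: y_def dist_norm)
    moreover have "(x - b) + (w + (e / norm u) *\<^sub>R u) \<in> W"
      using x w(1) u(1) W(1) by (intro subspace_add subspace_scale) (auto simp: F_def)
    then have "y - b \<in> W" by (simp add: y_def algebra_simps)
    ultimately have "y \<in> F" using e by (auto simp: F_def)
    then have "y \<bullet> u \<le> x \<bullet> u" by (rule max)
    moreover have "0 < (e / norm u) * (u \<bullet> u)" using e u(2) by simp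
    ultimately show False using w(2) by (simp add: y_def inner_add_left inner_add_right inner_commute)
  qed
  have "x \<notin> interior B" using no_int[of 0] subspace_0[OF W(1)] by simp
  then have "x \<in> frontier B"
    using x closure_subset[of B] by (auto simp: F_def frontier_def)
  moreover have "\<not> illuminates B l x" if "l \<in> L" for l
    using that no_int W u(3) by (auto simp: illuminates_def subspace_scale subset_iff)
  ultimately show ?thesis
    using that x by (auto simp: dark_set_def F_def)
qed

text \<open>
  The projection along \<open>W\<close> is expressed by the coordinates with respect to an orthonormal basis of
  the orthogonal complement of \<open>W\<close>; dark set and body have the same image, and the image of a ball
  in the body contains a box.
\<close>

lemma hausdorff_dim_dark_set:
  fixes B :: "'a::euclidean_space set"
  assumes B: "compact B" "interior B \<noteq> {}"
    and L: "finite L" "L \<noteq> {}" "card L \<le> DIM('a)"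
  shows "ereal (DIM('a) - card L) \<le> hausdorff_dim (dark_set B L)"
proof -
  obtain W u where W: "subspace W" "L \<subseteq> W" "dim W \<le> card L"
    and u: "u \<in> W" "u \<noteq> 0" "\<And>l. l \<in> L \<Longrightarrow> 0 \<le> u \<bullet> l"
    using nonneg_direction_exists[OF L] by blast
  define W' where "W' = {y. \<forall>x\<in>W. orthogonal x y}"
  have "subspace W'" unfolding W'_def by (rule subspace_orthogonal_to_vectors)
  then obtain V where V: "V \<subseteq> W'" "pairwise orthogonal V" "\<And>v. v \<in> V \<Longrightarrow> norm v = 1"
    "independent V" "card V = dim W'"
    using orthonormal_basis_subspace by metis
  have fin: "finite V" using V(4) by (rule independent_imp_finite)
  have "dim W' + dim W = DIM('a)"
    using dim_subspace_orthogonal_to_vectors[OF W(1) subspace_UNIV] by (simp add: W'_def)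
  then have card: "DIM('a) - card L \<le> card V" using W(3) V(5) by simp
  obtain c e where e: "0 < e" "cball c e \<subseteq> B"
    using B(2) by (auto simp: mem_interior_cball)
  \<comment> \<open>Small enough for \<open>card V\<close> orthogonal steps of length \<open>r\<close> to stay in the ball; the added \<open>1\<close>
    covers \<open>V = {}\<close>.\<close>
  define r where "r = e / (card V + 1)"
  have r: "0 < r" using e by (simp add: r_def)
  have "(\<Pi>\<^sub>E v\<in>V. {c \<bullet> v - r..c \<bullet> v + r}) \<subseteq> (\<lambda>x. \<lambda>v\<in>V. x \<bullet> v) ` dark_set B L"
  proof
    fix z assume z: "z \<in> (\<Pi>\<^sub>E v\<in>V. {c \<bullet> v - r..c \<bullet> v + r})"
    \<comment> \<open>The point of the ball with coordinates \<open>z\<close>.\<close>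
    define b where "b = c + (\<Sum>v\<in>V. (z v - c \<bullet> v) *\<^sub>R v)"
    have "norm (\<Sum>v\<in>V. (z v - c \<bullet> v) *\<^sub>R v) \<le> (\<Sum>v\<in>V. r)"
      using z V(3) by (intro sum_norm_le) (force simp: abs_le_iff PiE_iff)
    also have "\<dots> \<le> e" using e by (simp add: r_def field_simps)
    finally have "b \<in> B" using e(2) by (auto simp: b_def dist_norm)
    then obtain x where x: "x \<in> dark_set B L" "x - b \<in> W"
      using dark_point_in_fibre[OF B(1) W(1,2) u] by blast
    have "x \<bullet> v = z v" if v: "v \<in> V" for v
    proof -
      have "(\<Sum>w\<in>V. (z w - c \<bullet> w) *\<^sub>R w) \<bullet> v = (\<Sum>w\<in>V. if w = v then z v - c \<bullet> v else 0)"
        unfolding inner_sum_left using V(2,3) v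
        by (intro sum.cong) (auto simp: pairwise_def orthogonal_def dot_square_norm)
      then have "b \<bullet> v = z v" using v fin by (simp add: b_def inner_add_left)
      moreover have "(x - b) \<bullet> v = 0"
        using x(2) V(1) v by (auto simp: W'_def orthogonal_def)
      ultimately show ?thesis by (simp add: inner_diff_left)
    qed
    then have "z = (\<lambda>v\<in>V. x \<bullet> v)" using z by (auto simp: fun_eq_iff PiE_iff extensional_def)
    then show "z \<in> (\<lambda>x. \<lambda>v\<in>V. x \<bullet> v) ` dark_set B L" using x(1) by blast
  qed
  then have "ereal (card V) \<le> hausdorff_dim (dark_set B L)"
    by (intro hausdorff_dim_ge_box[OF fin V(3) r])
  moreover have "ereal (DIM('a) - card L) \<le> ereal (card V)" using card by simp
  ultimately show ?thesis by (rule order_trans[rotated])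
qed

theorem theorem2:
  fixes B :: "(real ^ 'd) set" and \<alpha> :: real
  assumes "convex_body B" and "0 \<le> \<alpha>"
  shows "int (illumination_number \<alpha> B) \<ge> int CARD('d) + 1 - \<lceil>\<alpha>\<rceil>"
proof (rule ccontr)
  assume few: "\<not> ?thesis"
  have "\<exists>n L. illuminating_set \<alpha> B L \<and> card L = n"
    using illuminating_set_exists[OF assms(1)] by blast
  then have "\<exists>L. illuminating_set \<alpha> B L \<and> card L = illumination_number \<alpha> B"
    unfolding illumination_number_def by (rule LeastI_ex)
  then obtain L where L: "illuminating_set \<alpha> B L" "card L = illumination_number \<alpha> B"
    by blast
  have "0 \<le> \<lceil>\<alpha>\<rceil>" using assms(2) by simp
  then have le: "card L \<le> CARD('d)" and \<alpha>: "\<lceil>\<alpha>\<rceil> \<le> int (CARD('d) - card L)"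
    using few L(2) by linarith+
  have "hausdorff_dim (dark_set B L) < ereal \<alpha>" using L(1) by (simp add: illuminating_set_def)
  also have "\<alpha> \<le> real (CARD('d) - card L)" using \<alpha> by (simp add: ceiling_le_iff)
  then have "ereal \<alpha> \<le> ereal (real (DIM(real ^ 'd) - card L))" by simp
  also have "\<dots> \<le> hausdorff_dim (dark_set B L)"
    using assms(1) L(1) le
    by (intro hausdorff_dim_dark_set) (auto simp: convex_body_def illuminating_set_def)
  finally show False by simp
qed

end
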